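(* Let $p$ be a prime and let $G$ be a finite group of nilpotency class $2$ with $|G'|=p$. Let $k\ge 1$ be a natural number and $w_k=[x_1,y_1]\cdots[x_k,y_k]$. Then $N_{w_k}(g)\geq |G|^{2k-1}$ for every $g\in G'$.
   Context: $G'$ denotes the derived (commutator) subgroup of $G$. The word $w_k=[x_1,y_1]\cdots[x_k,y_k]$ is viewed as an element of the free group on the $2k$ distinct variables $x_1,y_1,\ldots,x_k,y_k$, where $[x,y]$ is the group commutator. For a finite group $G$ and $g\in G$, $N_{w_k}(g)$ is the number of $2k$-tuples $(a_1,b_1,\ldots,a_k,b_k)\in G^{2k}$ with $[a_1,b_1]\cdots[a_k,b_k]=g$. *)

theory Defs
  imports "HOL-Algebra.Algebra" "HOL-Computational_Algebra.Primes"
begin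

text \<open>The convention \<open>[x, y] = x y x\<inverse> y\<inverse>\<close> is the one used by \<^const>\<open>derived\<close>.\<close>

definition commutator :: "('a, 'b) monoid_scheme \<Rightarrow> 'a \<Rightarrow> 'a \<Rightarrow> 'a" where
  "commutator G x y = x \<otimes>\<^bsub>G\<^esub> y \<otimes>\<^bsub>G\<^esub> inv\<^bsub>G\<^esub> x \<otimes>\<^bsub>G\<^esub> inv\<^bsub>G\<^esub> y"

text \<open>Indexing starts at \<open>0\<close> (the usual \<open>\<gamma>\<^sub>1(G) = G\<close> is term \<open>0\<close>), so that the nilpotency class
  is the least index whose term is trivial.\<close>

primrec lower_central :: "('a, 'b) monoid_scheme \<Rightarrow> nat \<Rightarrow> 'a set" where
  "lower_central G 0 = carrier G"
| "lower_central G (Suc n) =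
     generate G {commutator G x y | x y. x \<in> lower_central G n \<and> y \<in> carrier G}"

definition nilpotent :: "('a, 'b) monoid_scheme \<Rightarrow> bool" where
  "nilpotent G \<longleftrightarrow> (\<exists>n. lower_central G n = {\<one>\<^bsub>G\<^esub>})"

text \<open>Only meaningful for nilpotent groups.\<close>

definition nilpotency_class :: "('a, 'b) monoid_scheme \<Rightarrow> nat" where
  "nilpotency_class G = (LEAST n. lower_central G n = {\<one>\<^bsub>G\<^esub>})"

text \<open>The tuple \<open>(a\<^sub>1, b\<^sub>1, \<dots>, a\<^sub>k, b\<^sub>k)\<close> is represented by the list of pairs
  \<open>[(a\<^sub>1, b\<^sub>1), \<dots>, (a\<^sub>k, b\<^sub>k)]\<close>. The first function is the word map of
  \<open>w\<^sub>k = [x\<^sub>1, y\<^sub>1] \<cdots> [x\<^sub>k, y\<^sub>k]\<close>, with \<open>k\<close> the length of the list, and the second counts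
  the \<open>2k\<close>-tuples on which it takes the value \<open>g\<close>.\<close>

definition commutator_word_map :: "('a, 'b) monoid_scheme \<Rightarrow> ('a \<times> 'a) list \<Rightarrow> 'a" where
  "commutator_word_map G ps =
     foldr (\<otimes>\<^bsub>G\<^esub>) (map (\<lambda>(a, b). commutator G a b) ps) \<one>\<^bsub>G\<^esub>"

definition num_commutator_solutions :: "('a, 'b) monoid_scheme \<Rightarrow> nat \<Rightarrow> 'a \<Rightarrow> nat" where
  "num_commutator_solutions G k g =
     card {ps. length ps = k \<and> set ps \<subseteq> carrier G \<times> carrier G \<and> commutator_word_map G ps = g}"

end

theory Submission
  imports Defs
begin

text \<open>
  In class 2 the derived subgroup is central, so for fixed \<open>a\<close> the map \<open>b \<mapsto> [a, b]\<close> is a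
  homomorphism into \<open>G'\<close>, and \<open>[a z, b] = [a, b]\<close> for \<open>z \<in> G'\<close>. If \<open>a\<close> is not central, the
  homomorphism is onto \<open>G'\<close> because \<open>|G'|\<close> is prime, so all its fibres have \<open>|G| / p\<close> elements.
  The \<open>p\<close> translates \<open>a z\<close> hence give at least \<open>|G|\<close> solutions of \<open>[x, y] = g\<close>.
  For larger \<open>k\<close>, each of the \<open>|G|\<^sup>2\<close> choices of \<open>(a\<^sub>1, b\<^sub>1)\<close> leaves an equation of the same kind
  with \<open>k - 1\<close> commutators and right-hand side \<open>[a\<^sub>1, b\<^sub>1]\<inverse> g \<in> G'\<close>.
\<close>

text \<open>If \<open>h u = g\<close> and \<open>h v = y\<close>, left translation by
  \<open>u \<otimes> inv v\<close> injects the fibre over \<open>y\<close> into the fibre over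
  \<open>g\<close>. So no fibre is larger than the one over \<open>g\<close>, and the fibres over
  the image partition the group.\<close>

lemma (in group) order_le_card_image_times_card_fibre:
  assumes "finite (carrier G)" and hom: "h \<in> hom G G" and g: "g \<in> h ` carrier G"
  shows "order G \<le> card (h ` carrier G) * card {x \<in> carrier G. h x = g}"
proof -
  interpret h: group_hom G G h
    using hom by unfold_locales
  have "card {x \<in> carrier G. h x = y} \<le> card {x \<in> carrier G. h x = g}"
    if y: "y \<in> h ` carrier G" for y
  proof -
    obtain u where u: "u \<in> carrier G" "g = h u"
      using g by blast
    obtain v where v: "v \<in> carrier G" "y = h v"
      using y by blast
    show ?thesis
    proof (rule card_inj_on_le[where f = "\<lambda>x. u \<otimes> inv v \<otimes> x"])
      show "inj_on (\<lambda>x. u \<otimes> inv v \<otimes> x) {x \<in> carrier G. h x = y}"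
        using u v by (auto intro!: inj_onI)
      show "(\<lambda>x. u \<otimes> inv v \<otimes> x) ` {x \<in> carrier G. h x = y} \<subseteq> {x \<in> carrier G. h x = g}"
        using u v by (auto simp: m_assoc)
      show "finite {x \<in> carrier G. h x = g}"
        using assms(1) by simp
    qed
  qed
  moreover have "order G = (\<Sum>y\<in>h ` carrier G. card {x \<in> carrier G. h x = y})"
    unfolding order_def card_eq_sum
    using assms(1) by (rule sum.image_gen)
  ultimately show ?thesis
    using sum_bounded_above[of "h ` carrier G" "\<lambda>y. card {x \<in> carrier G. h x = y}"] by simp
qed

lemma (in group) commutator_closed [simp, intro]:
  "x \<in> carrier G \<Longrightarrow> y \<in> carrier G \<Longrightarrow> commutator G x y \<in> carrier G"
  by (simp add: commutator_def)

lemma (in group) commutator_in_derived: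
  "x \<in> carrier G \<Longrightarrow> y \<in> carrier G \<Longrightarrow> commutator G x y \<in> derived G (carrier G)"
  unfolding derived_def commutator_def by (auto intro!: generate.incl)

lemma (in group) commutator_eq_one_iff:
  assumes "x \<in> carrier G" "y \<in> carrier G"
  shows "commutator G x y = \<one> \<longleftrightarrow> x \<otimes> y = y \<otimes> x"
proof -
  have "commutator G x y = (x \<otimes> y) \<otimes> inv (y \<otimes> x)"
    using assms by (simp add: commutator_def inv_mult_group m_assoc)
  then show ?thesis
    using assms by (metis inv_equality inv_inv inv_closed m_closed r_inv)
qed

lemma (in group) lower_central_1: "lower_central G 1 = derived G (carrier G)"
  unfolding derived_def commutator_def One_nat_def lower_central.simps
  by (rule arg_cong[where f = "generate G"]) auto

lemma (in group) derived_central_if_nilpotency_class_2: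
  assumes "nilpotent G" "nilpotency_class G = 2"
    and z: "z \<in> derived G (carrier G)" and x: "x \<in> carrier G"
  shows "z \<otimes> x = x \<otimes> z"
proof -
  \<comment> \<open>The class is a \<open>LEAST\<close>, so nilpotency must supply some index before
    the term at that index is known to be trivial. Term 2 is [G', G], since indexing starts at
    0.\<close>
  have "lower_central G 2 = {\<one>}"
    using assms(1,2) unfolding nilpotent_def nilpotency_class_def by (metis (mono_tags) LeastI)
  then have "generate G {commutator G x y | x y. x \<in> derived G (carrier G) \<and> y \<in> carrier G} = {\<one>}"
    using lower_central_1 by (simp add: numeral_2_eq_2)
  then have "commutator G z x = \<one>"
    using z x generate.incl[of "commutator G z x"
      "{commutator G x y | x y. x \<in> derived G (carrier G) \<and> y \<in> carrier G}" G] by auto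
  moreover have "z \<in> carrier G"
    using z derived_in_carrier[of "carrier G"] by auto
  ultimately show ?thesis
    using x commutator_eq_one_iff by simp
qed

text \<open>In any group [a, bc] = (a b a^-1) [a, c] b^-1; centrality of [a, c] lets it move past
  b^-1, which completes [a, b].\<close>

lemma (in group) commutator_hom:
  assumes central: "\<And>z x. z \<in> derived G (carrier G) \<Longrightarrow> x \<in> carrier G \<Longrightarrow> z \<otimes> x = x \<otimes> z"
    and a: "a \<in> carrier G"
  shows "commutator G a \<in> hom G G"
proof (rule homI)
  fix b c assume bc: "b \<in> carrier G" "c \<in> carrier G"
  have "commutator G a (b \<otimes> c) = a \<otimes> b \<otimes> inv a \<otimes> (commutator G a c \<otimes> inv b)"
    using a bc by (simp add: commutator_def m_assoc inv_mult_group inv_solve_left)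
  also have "\<dots> = a \<otimes> b \<otimes> inv a \<otimes> (inv b \<otimes> commutator G a c)"
    using central[OF commutator_in_derived[OF a bc(2)], of "inv b"] bc by simp
  also have "\<dots> = commutator G a b \<otimes> commutator G a c"
    using a bc by (simp add: commutator_def m_assoc)
  finally show "commutator G a (b \<otimes> c) = commutator G a b \<otimes> commutator G a c" .
qed (use a in simp)

text \<open>Inside [az, b] the factor z moves past b and cancels against its own inverse.\<close>

lemma (in group) commutator_mult_central:
  assumes central: "\<And>x. x \<in> carrier G \<Longrightarrow> z \<otimes> x = x \<otimes> z"
    and "z \<in> carrier G" "a \<in> carrier G" "b \<in> carrier G"
  shows "commutator G (a \<otimes> z) b = commutator G a b"
proof -
  have "commutator G (a \<otimes> z) b = a \<otimes> (z \<otimes> b) \<otimes> inv z \<otimes> inv a \<otimes> inv b"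
    using assms(2-4) by (simp add: commutator_def m_assoc inv_mult_group)
  also have "\<dots> = a \<otimes> (b \<otimes> z) \<otimes> inv z \<otimes> inv a \<otimes> inv b"
    using central[of b] assms(4) by simp
  also have "\<dots> = a \<otimes> b \<otimes> (z \<otimes> inv z) \<otimes> inv a \<otimes> inv b"
    using assms(2-4) by (simp add: m_assoc del: r_inv)
  finally show ?thesis
    using assms(2-4) by (simp add: commutator_def)
qed

text \<open>Lagrange's theorem inside \<open>K\<close>: the order of \<open>H\<close> divides a
  prime and is not 1.\<close>

lemma (in group) subgroup_of_prime_order_subgroup:
  assumes "subgroup H G" "subgroup K G" "H \<subseteq> K" "H \<noteq> {\<one>}"
    and "Factorial_Ring.prime (card K)"
  shows "H = K"
proof -
  \<comment> \<open>An infinite set has \<open>card\<close> equal to 0, which is not prime.\<close>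
  have fin: "finite K"
    using assms(5) by (metis card.infinite not_prime_0)
  interpret K: group "G\<lparr>carrier := K\<rparr>"
    using assms(2) by (rule subgroup_imp_group)
  have "card (rcosets\<^bsub>G\<lparr>carrier := K\<rparr>\<^esub> H) * card H = card K"
    using K.lagrange[OF subgroup_incl[OF assms(1-3)]] by (simp add: order_def)
  then have "card H dvd card K"
    by (metis dvd_triv_right)
  moreover have "card H \<noteq> 1"
    using assms(1,4) subgroup.one_closed[of H G] by (auto simp: card_1_singleton_iff)
  ultimately have "card H = card K"
    using assms(5) by (auto simp: prime_nat_iff)
  then show ?thesis
    using fin assms(3) card_subset_eq by metis
qed

lemma (in group) order_le_card_commutator_pairs:
  assumes "finite (carrier G)"
    and central: "\<And>z x. z \<in> derived G (carrier G) \<Longrightarrow> x \<in> carrier G \<Longrightarrow> z \<otimes> x = x \<otimes> z"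
    and prime: "Factorial_Ring.prime (card (derived G (carrier G)))"
    and g: "g \<in> derived G (carrier G)"
  shows "order G \<le> card {(a, b) \<in> carrier G \<times> carrier G. commutator G a b = g}"
proof -
  let ?D = "derived G (carrier G)"
  have subD: "subgroup ?D G"
    by (simp add: derived_is_subgroup)
  have D: "?D \<subseteq> carrier G"
    by (simp add: derived_in_carrier)
  \<comment> \<open>A non-central \<open>a\<close> exists: if all commutators were trivial, G' would
    be generated by the identity and its order could not be prime.\<close>
  obtain a b where a: "a \<in> carrier G" and b: "b \<in> carrier G" and ab: "commutator G a b \<noteq> \<one>"
  proof -
    have "\<exists>a\<in>carrier G. \<exists>b\<in>carrier G. commutator G a b \<noteq> \<one>"
    proof (rule ccontr)
      assume "\<not> ?thesis"
      then have "derived_set G (carrier G) \<subseteq> {\<one>}"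
        by (auto simp: commutator_def)
      then have "?D \<subseteq> generate G {\<one>}"
        unfolding derived_def by (rule mono_generate)
      then have "card ?D \<le> 1"
        using card_mono[of "{\<one>}" ?D] by (simp add: generate_one)
      then show False
        using prime prime_gt_1_nat by (metis not_less)
    qed
    then show thesis
      using that by blast
  qed
  let ?h = "commutator G a"
  let ?F = "{b \<in> carrier G. commutator G a b = g}"
  interpret h: group_hom G G ?h
    using commutator_hom[OF central a] by unfold_locales
  have onto: "?h ` carrier G = ?D"
  proof (rule subgroup_of_prime_order_subgroup)
    show "subgroup (?h ` carrier G) G"
      by (rule h.img_is_subgroup)
    show "?h ` carrier G \<subseteq> ?D"
      using a commutator_in_derived by auto
    show "?h ` carrier G \<noteq> {\<one>}"
      using ab b by blast
  qed (use subD prime in auto)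
  have "order G \<le> card ?D * card ?F"
    using order_le_card_image_times_card_fibre[OF assms(1) h.homh, of g] g onto by simp
  \<comment> \<open>The factor |G'|, so far the size of the image, is reread as the number of
    translates \<open>a \<otimes> z\<close>, each of which has all of \<open>?F\<close> as solutions
    \<open>b\<close>.\<close>
  also have "\<dots> = card (?D \<times> ?F)"
    by (simp add: card_cartesian_product)
  also have "\<dots> \<le> card {(a, b) \<in> carrier G \<times> carrier G. commutator G a b = g}"
  proof (rule card_inj_on_le[where f = "\<lambda>(z, b). (a \<otimes> z, b)"])
    show "inj_on (\<lambda>(z, b). (a \<otimes> z, b)) (?D \<times> ?F)"
      using a D by (auto intro!: inj_onI simp: subset_iff)
    show "(\<lambda>(z, b). (a \<otimes> z, b)) ` (?D \<times> ?F) \<subseteq>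
        {(a, b) \<in> carrier G \<times> carrier G. commutator G a b = g}"
      using a D commutator_mult_central[OF central] by auto
    show "finite {(a, b) \<in> carrier G \<times> carrier G. commutator G a b = g}"
      by (rule finite_subset[of _ "carrier G \<times> carrier G"]) (use assms(1) in auto)
  qed
  finally show ?thesis .
qed

lemma commutator_word_map_Nil [simp]: "commutator_word_map G [] = \<one>\<^bsub>G\<^esub>"
  by (simp add: commutator_word_map_def)

lemma commutator_word_map_Cons [simp]:
  "commutator_word_map G ((a, b) # ps) = commutator G a b \<otimes>\<^bsub>G\<^esub> commutator_word_map G ps"
  by (simp add: commutator_word_map_def)

lemma (in group) commutator_word_map_closed:
  "set ps \<subseteq> carrier G \<times> carrier G \<Longrightarrow> commutator_word_map G ps \<in> carrier G"
  by (induction ps) auto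

lemma (in group) num_commutator_solutions_1:
  "num_commutator_solutions G 1 g = card {(a, b) \<in> carrier G \<times> carrier G. commutator G a b = g}"
  unfolding num_commutator_solutions_def
  by (rule bij_betw_same_card[of hd], rule bij_betwI[where g = "\<lambda>q. [q]"])
    (auto simp: length_Suc_conv)

text \<open>Once the first pair is fixed, the remaining word has to take the value obtained by
  cancelling the first commutator from the left of \<open>g\<close>.\<close>

lemma (in group) num_commutator_solutions_Suc:
  assumes "finite (carrier G)" "g \<in> carrier G"
  shows "num_commutator_solutions G (Suc k) g =
    (\<Sum>(a, b)\<in>carrier G \<times> carrier G. num_commutator_solutions G k (inv (commutator G a b) \<otimes> g))"
proof -
  let ?S = "\<lambda>k g. {ps. length ps = k \<and> set ps \<subseteq> carrier G \<times> carrier G \<and> commutator_word_map G ps = g}"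
  \<comment> \<open>A dependent sum, because the target of the remaining word varies with the first
    pair \<open>q\<close>.\<close>
  let ?T = "SIGMA q:carrier G \<times> carrier G. ?S k (inv (commutator G (fst q) (snd q)) \<otimes> g)"
  have fin: "finite (?S k h)" for h
    by (rule finite_subset[OF _ finite_lists_length_eq[of "carrier G \<times> carrier G" k]])
      (use assms(1) in auto)
  have "?S (Suc k) g = (\<lambda>(q, ps). q # ps) ` ?T"
  proof (intro equalityI subsetI)
    fix ps assume "ps \<in> ?S (Suc k) g"
    then obtain a b qs where ps: "ps = (a, b) # qs" "length qs = k" "a \<in> carrier G"
        "b \<in> carrier G" "set qs \<subseteq> carrier G \<times> carrier G"
        "commutator G a b \<otimes> commutator_word_map G qs = g"
      by (auto simp: length_Suc_conv)
    then have "((a, b), qs) \<in> ?T"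
      \<comment> \<open>Reassociating to the left puts the commutator next to its inverse.\<close>
      using commutator_word_map_closed[of qs] by (auto simp flip: m_assoc)
    then show "ps \<in> (\<lambda>(q, ps). q # ps) ` ?T"
      using ps(1) by (auto intro!: image_eqI[where x = "((a, b), qs)"])
  next
    fix ps assume "ps \<in> (\<lambda>(q, ps). q # ps) ` ?T"
    then show "ps \<in> ?S (Suc k) g"
      using assms(2) by (auto simp flip: m_assoc)
  qed
  then have "num_commutator_solutions G (Suc k) g = card ((\<lambda>(q, ps). q # ps) ` ?T)"
    unfolding num_commutator_solutions_def by simp
  also have "\<dots> = card ?T"
    by (rule card_image) (auto intro!: inj_onI)
  also have "\<dots> = (\<Sum>q\<in>carrier G \<times> carrier G. card (?S k (inv (commutator G (fst q) (snd q)) \<otimes> g)))"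
    using fin assms(1) by (subst card_SigmaI) auto
  finally show ?thesis
    unfolding num_commutator_solutions_def by (simp add: case_prod_unfold)
qed

theorem corollaryD:
  fixes G :: "('a, 'b) monoid_scheme" and p k :: nat and g :: 'a
  assumes "Factorial_Ring.prime p"
    and "group G" and "finite (carrier G)"
    and "nilpotent G" and "nilpotency_class G = 2"
    and "card (derived G (carrier G)) = p"
    and "k \<ge> 1"
    and "g \<in> derived G (carrier G)"
  shows "num_commutator_solutions G k g \<ge> order G ^ (2 * k - 1)"
proof -
  interpret group G by fact
  let ?D = "derived G (carrier G)"
  have sub: "subgroup ?D G"
    by (simp add: derived_is_subgroup)
  show ?thesis
    using assms(7,8)
  \<comment> \<open>The target \<open>g\<close> must vary, as the recursion changes it. The
    induction starts at 1: the empty word attains only the identity, so the bound fails for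
    \<open>k = 0\<close> and other \<open>g\<close>.\<close>
  proof (induction k arbitrary: g rule: nat_induct_at_least)
    case base
    then show ?case
      using order_le_card_commutator_pairs[OF assms(3)
          derived_central_if_nilpotency_class_2[OF assms(4,5)]] assms(1,6)
      by (simp add: num_commutator_solutions_1[simplified])
  next
    case (Suc k)
    \<comment> \<open>The new target is again in G', being a product of elements of G', so the
      induction hypothesis applies to it.\<close>
    have bound: "order G ^ (2 * k - 1) \<le>
        num_commutator_solutions G k (inv\<^bsub>G\<^esub> (commutator G a b) \<otimes>\<^bsub>G\<^esub> g)"
      if "a \<in> carrier G" "b \<in> carrier G" for a b
      using Suc.IH Suc.prems that commutator_in_derived sub
      by (simp add: subgroup.m_closed subgroup.m_inv_closed)
    \<comment> \<open>Since \<open>k \<ge> 1\<close>, the natural subtraction does not truncate. The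
      extra exponent 2 counts the choices of the first pair.\<close>
    have "order G ^ (2 * Suc k - 1) = order G ^ (2 + (2 * k - 1))"
      using Suc.hyps by (intro arg_cong[where f = "power (order G)"]) simp
    also have "\<dots> = (\<Sum>(a, b)\<in>carrier G \<times> carrier G. order G ^ (2 * k - 1))"
      by (simp add: power_add power2_eq_square card_cartesian_product order_def case_prod_unfold)
    also have "\<dots> \<le> (\<Sum>(a, b)\<in>carrier G \<times> carrier G.
        num_commutator_solutions G k (inv\<^bsub>G\<^esub> (commutator G a b) \<otimes>\<^bsub>G\<^esub> g))"
      by (rule sum_mono) (use bound in \<open>auto simp: case_prod_unfold\<close>)
    also have "\<dots> = num_commutator_solutions G (Suc k) g"
      using num_commutator_solutions_Suc[OF assms(3)] Suc.prems subgroup.mem_carrier[OF sub] by simp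
    finally show ?case .
  qed
qed

end
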